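(* Let $(X,\tau)$ be a topological space and $\delta$ a quasi-proximity compatible with $\tau$ such that $\mathcal{V}_\delta$ is transitive. Then either $|\pi(\delta)|=1$ or $|\pi(\delta)|\ge 2^{2^{\aleph_0}}$; moreover, either $|\pi(\delta)\cap T(\tau)|=1$ or $|\pi(\delta)\cap T(\tau)|\ge 2^{2^{\aleph_0}}$.
   Context: Quasi-uniformities and quasi-proximities are in the sense of Fletcher–Lindgren; compatible means inducing $\tau$. $\pi(\delta)$ is the set of all quasi-uniformities $\mathcal{V}$ on $X$ with $\delta(\mathcal{V})=\delta$, and $\mathcal{V}_\delta$ is its coarsest (totally bounded) element. A quasi-uniformity is transitive if it has a base of transitive entourages ($U\circ U\subseteq U$). $T(\tau)$ is the set of compatible transitive quasi-uniformities on $(X,\tau)$. *)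

theory Defs
  imports "HOL-Analysis.Analysis" "HOL-Library.Equipollence"
begin

definition quasi_uniformity :: "'a set \<Rightarrow> ('a \<times> 'a) set set \<Rightarrow> bool" where
  "quasi_uniformity X \<U> \<longleftrightarrow>
     \<U> \<noteq> {} \<and>
     (\<forall>U\<in>\<U>. Id_on X \<subseteq> U \<and> U \<subseteq> X \<times> X) \<and>
     (\<forall>U\<in>\<U>. \<forall>V\<in>\<U>. U \<inter> V \<in> \<U>) \<and>
     (\<forall>U\<in>\<U>. \<forall>V. U \<subseteq> V \<and> V \<subseteq> X \<times> X \<longrightarrow> V \<in> \<U>) \<and>
     (\<forall>U\<in>\<U>. \<exists>V\<in>\<U>. V O V \<subseteq> U)"

definition qu_compatible :: "'a topology \<Rightarrow> ('a \<times> 'a) set set \<Rightarrow> bool" where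
  "qu_compatible T \<U> \<longleftrightarrow>
     (\<forall>G. openin T G \<longleftrightarrow> G \<subseteq> topspace T \<and> (\<forall>x\<in>G. \<exists>U\<in>\<U>. U `` {x} \<subseteq> G))"

definition transitive_qu :: "('a \<times> 'a) set set \<Rightarrow> bool" where
  "transitive_qu \<U> \<longleftrightarrow> (\<forall>U\<in>\<U>. \<exists>W\<in>\<U>. trans W \<and> W \<subseteq> U)"

definition quasi_proximity :: "'a set \<Rightarrow> ('a set \<Rightarrow> 'a set \<Rightarrow> bool) \<Rightarrow> bool" where
  "quasi_proximity X \<delta> \<longleftrightarrow>
     (\<forall>A B. \<delta> A B \<longrightarrow> A \<subseteq> X \<and> B \<subseteq> X) \<and>
     (\<forall>A B C. A \<subseteq> X \<and> B \<subseteq> X \<and> C \<subseteq> X \<longrightarrow>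
        (\<delta> A (B \<union> C) \<longleftrightarrow> \<delta> A B \<or> \<delta> A C) \<and>
        (\<delta> (A \<union> B) C \<longleftrightarrow> \<delta> A C \<or> \<delta> B C)) \<and>
     (\<forall>A B. \<delta> A B \<longrightarrow> A \<noteq> {} \<and> B \<noteq> {}) \<and>
     (\<forall>A B. A \<subseteq> X \<and> B \<subseteq> X \<and> A \<inter> B \<noteq> {} \<longrightarrow> \<delta> A B) \<and>
     (\<forall>A B. A \<subseteq> X \<and> B \<subseteq> X \<and> \<not> \<delta> A B \<longrightarrow>
        (\<exists>C. C \<subseteq> X \<and> \<not> \<delta> A C \<and> \<not> \<delta> (X - C) B))"

text \<open>The quasi-proximity induces the topology of T: closure of A is
  the set of x with {x} delta A, i.e. G is open iff {x} is not near X - G for x in G.\<close>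
definition qp_compatible :: "'a topology \<Rightarrow> ('a set \<Rightarrow> 'a set \<Rightarrow> bool) \<Rightarrow> bool" where
  "qp_compatible T \<delta> \<longleftrightarrow>
     (\<forall>G. openin T G \<longleftrightarrow> G \<subseteq> topspace T \<and> (\<forall>x\<in>G. \<not> \<delta> {x} (topspace T - G)))"

definition qu_proximity :: "'a set \<Rightarrow> ('a \<times> 'a) set set \<Rightarrow> 'a set \<Rightarrow> 'a set \<Rightarrow> bool" where
  "qu_proximity X \<U> A B \<longleftrightarrow> A \<subseteq> X \<and> B \<subseteq> X \<and> (\<forall>U\<in>\<U>. (A \<times> B) \<inter> U \<noteq> {})"

definition qprox_class :: "'a set \<Rightarrow> ('a set \<Rightarrow> 'a set \<Rightarrow> bool) \<Rightarrow> ('a \<times> 'a) set set set" where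
  "qprox_class X \<delta> = {\<U>. quasi_uniformity X \<U> \<and> qu_proximity X \<U> = \<delta>}"

definition trans_qus :: "'a topology \<Rightarrow> ('a \<times> 'a) set set set" where
  "trans_qus T = {\<U>. quasi_uniformity (topspace T) \<U> \<and> qu_compatible T \<U> \<and> transitive_qu \<U>}"

end

theory Submission
  imports Defs "HOL-Library.Ramsey" "HOL-Library.Diagonal_Subsequence" "HOL-Library.Nat_Bijection"
begin

text \<open>
  Let \<open>\<V>\<close> be the coarsest member of the class and \<open>\<U>\<close> another one. An entourage \<open>U \<in> \<U> - \<V>\<close>
  is controlled by a bounded quasi-pseudometric \<open>d\<close> (two-valued if \<open>U\<close> is transitive), and since
  \<open>U \<notin> \<V>\<close> there is a sequence \<open>x\<close> any two terms of which have distance at least \<open>r > 0\<close> in one of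
  the two directions. By Ramsey's theorem and a diagonal argument, \<open>d (x i) (x j)\<close> and \<open>d (x j) (x i)\<close>
  both converge as \<open>i < j\<close> tend to infinity. Cut the sequence into longer and longer blocks. A set \<open>A\<close> of blocks
  gives the entourages \<open>W A e\<close> requiring \<open>d (x j) z < d (x j) y + e\<close> for all \<open>j\<close> in the blocks of
  \<open>A\<close>. For a family \<open>S\<close> taken from an almost disjoint family of continuum many sets, \<open>\<V>\<close> together with the
  \<open>W A e\<close>, \<open>A \<in> S\<close>, generates a quasi-uniformity between \<open>\<V>\<close> and \<open>\<U>\<close>, hence one inducing the
  same quasi-proximity. As \<open>\<V>\<close> is totally bounded, a pigeonhole argument in a long block shows
  that different \<open>S\<close> give different quasi-uniformities.
\<close>

subsection \<open>Ramsey's theorem for bounded real-valued functions on pairs\<close>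

text \<open>Colour a pair \<open>i < j\<close> by the integer part of
  \<open>(n + 1) * D i j\<close>. On an infinite homogeneous set the integer parts agree, so the
  values of \<open>D\<close> differ by at most \<open>1 / (n + 1)\<close>.\<close>

lemma Ramsey_oscillation:
  fixes D :: "nat \<Rightarrow> nat \<Rightarrow> real"
  assumes "\<And>i j. 0 \<le> D i j" "\<And>i j. D i j \<le> 1"
  obtains r :: "nat \<Rightarrow> nat" where "strict_mono r"
    "\<And>i j k l. i < j \<Longrightarrow> k < l \<Longrightarrow> \<bar>D (r i) (r j) - D (r k) (r l)\<bar> \<le> 1 / real (Suc n)"
proof -
  define E where "E i j = real (Suc n) * D i j" for i j
  define f where "f A = nat \<lfloor>E (Min A) (Max A)\<rfloor>" for A :: "nat set"
  have E: "0 \<le> E i j" "E i j \<le> real (Suc n)" for i j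
    using assms mult_left_mono[of "D i j" 1 "real (Suc n)"] by (auto simp: E_def)
  \<comment> \<open>The value \<open>1\<close> of \<open>D\<close> has the colour
    \<open>n + 1\<close>, hence \<open>n + 2\<close> colours.\<close>
  have "f A < n + 2" for A
    using E[of "Min A" "Max A"] unfolding f_def by linarith
  then have "\<exists>Y t. Y \<subseteq> (UNIV :: nat set) \<and> infinite Y \<and> t < n + 2 \<and>
      (\<forall>x\<in>Y. \<forall>y\<in>Y. x \<noteq> y \<longrightarrow> f {x, y} = t)"
    by (intro Ramsey2) auto
  then obtain Y t where Y: "infinite Y" "\<forall>x\<in>Y. \<forall>y\<in>Y. x \<noteq> y \<longrightarrow> f {x, y} = t"
    by (elim exE conjE)
  have floor_eq: "\<lfloor>E (enumerate Y i) (enumerate Y j)\<rfloor> = int t" if "i < j" for i j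
  proof -
    have less: "enumerate Y i < enumerate Y j"
      using that Y(1) by (simp add: enumerate_mono)
    then have "f {enumerate Y i, enumerate Y j} = t"
      using Y(2) enumerate_in_set[OF Y(1)] by (metis less_irrefl)
    with less have "nat \<lfloor>E (enumerate Y i) (enumerate Y j)\<rfloor> = t"
      by (simp add: f_def)
    with E(1)[of "enumerate Y i" "enumerate Y j"] show ?thesis by linarith
  qed
  show ?thesis
  proof (rule that)
    show "strict_mono (enumerate Y)"
      using Y(1) by (simp add: strict_mono_enumerate)
    fix i j k l :: nat
    assume "i < j" "k < l"
    then have "\<bar>E (enumerate Y i) (enumerate Y j) - E (enumerate Y k) (enumerate Y l)\<bar> \<le> 1"
      using floor_eq[of i j] floor_eq[of k l] by linarith
    then have "real (Suc n) * \<bar>D (enumerate Y i) (enumerate Y j) - D (enumerate Y k) (enumerate Y l)\<bar> \<le> 1"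
      unfolding E_def right_diff_distrib[symmetric] abs_mult by simp
    then show "\<bar>D (enumerate Y i) (enumerate Y j) - D (enumerate Y k) (enumerate Y l)\<bar> \<le> 1 / real (Suc n)"
      by (simp add: field_simps)
  qed
qed

definition pairs_Cauchy :: "(nat \<Rightarrow> nat \<Rightarrow> real) \<Rightarrow> bool" where
  "pairs_Cauchy D \<longleftrightarrow> (\<forall>e>0. \<exists>N. \<forall>i j k l. N \<le> i \<and> i < j \<and> N \<le> k \<and> k < l \<longrightarrow>
     \<bar>D i j - D k l\<bar> < e)"

lemma pairs_Cauchy_subseq:
  assumes "pairs_Cauchy D" "strict_mono r"
  shows "pairs_Cauchy (\<lambda>i j. D (r i) (r j))"
  unfolding pairs_Cauchy_def
proof (intro allI impI)
  fix e :: real assume "e > 0"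
  then obtain N where N: "\<And>i j k l. N \<le> i \<Longrightarrow> i < j \<Longrightarrow> N \<le> k \<Longrightarrow> k < l \<Longrightarrow> \<bar>D i j - D k l\<bar> < e"
    using assms(1) unfolding pairs_Cauchy_def by meson
  have "N \<le> r i" if "N \<le> i" for i
    using that seq_suble[OF assms(2), of i] by linarith
  then show "\<exists>N. \<forall>i j k l. N \<le> i \<and> i < j \<and> N \<le> k \<and> k < l \<longrightarrow> \<bar>D (r i) (r j) - D (r k) (r l)\<bar> < e"
    using N assms(2) by (meson strict_monoD)
qed

text \<open>Stage \<open>n\<close> of a diagonal construction bounds the oscillation by
  \<open>1 / (n + 1)\<close>. The bound passes to further subsequences, hence to the diagonal
  sequence without its first \<open>n + 1\<close> terms.\<close>

lemma ex_subseq_pairs_Cauchy: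
  fixes D :: "nat \<Rightarrow> nat \<Rightarrow> real"
  assumes D: "\<And>i j. 0 \<le> D i j" "\<And>i j. D i j \<le> 1"
  obtains r :: "nat \<Rightarrow> nat" where "strict_mono r" "pairs_Cauchy (\<lambda>i j. D (r i) (r j))"
proof -
  define P where "P n s \<longleftrightarrow> (\<forall>i j k l. i < j \<and> k < l \<longrightarrow>
      \<bar>D (s i) (s j) - D (s k) (s l)\<bar> \<le> 1 / real (Suc n))" for n :: nat and s :: "nat \<Rightarrow> nat"
  interpret subseqs P
  proof
    fix n :: nat and s :: "nat \<Rightarrow> nat"
    obtain r :: "nat \<Rightarrow> nat" where "strict_mono r" "\<And>i j k l. i < j \<Longrightarrow> k < l \<Longrightarrow>
        \<bar>D (s (r i)) (s (r j)) - D (s (r k)) (s (r l))\<bar> \<le> 1 / real (Suc n)"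
      using Ramsey_oscillation[of "\<lambda>i j. D (s i) (s j)" n] D by blast
    then show "\<exists>r. strict_mono r \<and> P n (s \<circ> r)"
      unfolding P_def by (intro exI[of _ r]) simp
  qed
  have P: "P k (diagseq \<circ> (+) (Suc k))" for k
    by (rule diagseq_holds) (simp add: P_def strict_monoD)
  have "pairs_Cauchy (\<lambda>i j. D (diagseq i) (diagseq j))"
    unfolding pairs_Cauchy_def
  proof (intro allI impI)
    fix e :: real assume "e > 0"
    then obtain n where n: "1 / real (Suc n) < e"
      using nat_approx_posE by blast
    show "\<exists>N. \<forall>i j k l. N \<le> i \<and> i < j \<and> N \<le> k \<and> k < l \<longrightarrow>
        \<bar>D (diagseq i) (diagseq j) - D (diagseq k) (diagseq l)\<bar> < e"
    proof (intro exI[of _ "Suc n"] allI impI)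
      fix i j k l assume *: "Suc n \<le> i \<and> i < j \<and> Suc n \<le> k \<and> k < l"
      then have "i - Suc n < j - Suc n" "k - Suc n < l - Suc n" by auto
      then have "\<bar>D (diagseq (Suc n + (i - Suc n))) (diagseq (Suc n + (j - Suc n)))
          - D (diagseq (Suc n + (k - Suc n))) (diagseq (Suc n + (l - Suc n)))\<bar> \<le> 1 / real (Suc n)"
        using P[of n] unfolding P_def comp_def by blast
      with * n show "\<bar>D (diagseq i) (diagseq j) - D (diagseq k) (diagseq l)\<bar> < e"
        by simp
    qed
  qed
  with subseq_diagseq show ?thesis using that by blast
qed

lemma ex_subseq_pairs_Cauchy_both:
  fixes D :: "nat \<Rightarrow> nat \<Rightarrow> real"
  assumes D: "\<And>i j. 0 \<le> D i j" "\<And>i j. D i j \<le> 1"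
  obtains r :: "nat \<Rightarrow> nat" where "strict_mono r" "pairs_Cauchy (\<lambda>i j. D (r i) (r j))"
    "pairs_Cauchy (\<lambda>i j. D (r j) (r i))"
proof -
  obtain r :: "nat \<Rightarrow> nat" where r: "strict_mono r" "pairs_Cauchy (\<lambda>i j. D (r i) (r j))"
    using ex_subseq_pairs_Cauchy[of D] D by blast
  obtain s :: "nat \<Rightarrow> nat" where s: "strict_mono s" "pairs_Cauchy (\<lambda>i j. D (r (s j)) (r (s i)))"
    using ex_subseq_pairs_Cauchy[of "\<lambda>i j. D (r j) (r i)"] D by blast
  show ?thesis
    using that[of "\<lambda>i. r (s i)"] s pairs_Cauchy_subseq[OF r(2) s(1)] strict_mono_o[OF r(1) s(1)]
    by (simp add: comp_def)
qed

subsection \<open>Almost disjoint sets\<close>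

text \<open>The set of codes of the finite initial segments of \<open>s\<close>: a branch of the binary tree.\<close>

definition branch :: "nat set \<Rightarrow> nat set" where
  "branch s = range (\<lambda>n. prod_encode (n, set_encode (s \<inter> {..<n})))"

lemma infinite_branch: "infinite (branch s)"
proof -
  have "inj (\<lambda>n. prod_encode (n, set_encode (s \<inter> {..<n})))"
    by (auto simp: inj_on_def)
  then show ?thesis unfolding branch_def using finite_imageD by blast
qed

text \<open>A code determines its level \<open>n\<close> and the segment below \<open>n\<close>, so
  a common code forces \<open>s\<close> and \<open>t\<close> to agree below \<open>n\<close>. A
  point where they differ therefore bounds \<open>n\<close>.\<close>

lemma finite_branch_Int:
  assumes "s \<noteq> t" shows "finite (branch s \<inter> branch t)"
proof -
  obtain k where k: "(k \<in> s) \<noteq> (k \<in> t)" using assms by blast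
  have "branch s \<inter> branch t \<subseteq> (\<lambda>n. prod_encode (n, set_encode (s \<inter> {..<n}))) ` {..k}"
  proof
    fix m assume "m \<in> branch s \<inter> branch t"
    then obtain n where n: "m = prod_encode (n, set_encode (s \<inter> {..<n}))"
      "set_encode (s \<inter> {..<n}) = set_encode (t \<inter> {..<n})"
      by (auto simp: branch_def)
    then have "s \<inter> {..<n} = t \<inter> {..<n}" by (simp add: set_encode_eq)
    with k have "n \<le> k" by (metis Int_iff lessThan_iff not_le)
    with n show "m \<in> (\<lambda>n. prod_encode (n, set_encode (s \<inter> {..<n}))) ` {..k}" by blast
  qed
  then show ?thesis using finite_surj by blast
qed

text \<open>Finitely many other branches remove only finitely many elements. This independence is
  what separates the quasi-uniformities in \<open>gen_inj\<close>.\<close>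

lemma infinite_branch_minus:
  assumes "finite F" "s \<notin> F" shows "infinite (branch s - \<Union> (branch ` F))"
proof
  assume "finite (branch s - \<Union> (branch ` F))"
  moreover have "finite (\<Union>t\<in>F. branch s \<inter> branch t)"
  proof (intro finite_UN_I finite_branch_Int)
    show "s \<noteq> t" if "t \<in> F" for t using that assms by blast
  qed (use assms in blast)
  ultimately have "finite ((branch s - \<Union> (branch ` F)) \<union> (\<Union>t\<in>F. branch s \<inter> branch t))"
    by blast
  then have "finite (branch s)" by (rule rev_finite_subset) blast
  then show False by (simp add: infinite_branch)
qed

subsection \<open>Quasi-pseudometrization\<close>

definition quasi_pseudometric :: "('a \<Rightarrow> 'a \<Rightarrow> real) \<Rightarrow> bool" where
  "quasi_pseudometric d \<longleftrightarrow> (\<forall>x. d x x = 0) \<and> (\<forall>x y. 0 \<le> d x y) \<and> (\<forall>x y z. d x z \<le> d x y + d y z)"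

text \<open>Cutting the chain at the half of its total length leaves two shorter chains and one link,
  each of which has \<open>g\<close>-distance at most the total length.\<close>

lemma chain_bound:
  fixes g :: "'a \<Rightarrow> 'a \<Rightarrow> real" and p :: "nat \<Rightarrow> 'a"
  assumes refl: "\<And>x. g x x = 0" and nonneg: "\<And>x y. 0 \<le> g x y"
    and three: "\<And>x y z w e. g x y \<le> e \<Longrightarrow> g y z \<le> e \<Longrightarrow> g z w \<le> e \<Longrightarrow> g x w \<le> 2 * e"
  shows "g (p 0) (p n) \<le> 2 * (\<Sum>i<n. g (p i) (p (Suc i)))"
proof (induction n arbitrary: p rule: less_induct)
  case (less n)
  show ?case
  proof (cases "n = 0")
    case True
    then show ?thesis by (simp add: refl)
  next
    case False
    define S where "S a b = (\<Sum>i=a..<b. g (p i) (p (Suc i)))" for a b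
    define s where "s = S 0 n"
    \<comment> \<open>The link cut out starts at \<open>Max K\<close>: the chain before it has at
      most half the length, and by maximality so has the chain after it, which is empty if the link
      is the last one.\<close>
    define K where "K = {k. k < n \<and> S 0 k \<le> s / 2}"
    have S_nonneg: "0 \<le> S a b" for a b
      by (simp add: S_def sum_nonneg nonneg)
    have split: "S a b + S b c = S a c" if "a \<le> b" "b \<le> c" for a b c
      using that by (simp add: S_def sum.atLeastLessThan_concat)
    have IH: "g (p a) (p b) \<le> 2 * S a b" if "a \<le> b" "b - a < n" for a b
    proof -
      have "g (p (a + 0)) (p (a + (b - a))) \<le> 2 * (\<Sum>i<b - a. g (p (a + i)) (p (a + Suc i)))"
        using less.IH[of "b - a" "\<lambda>i. p (a + i)"] that by simp
      also have "(\<Sum>i<b - a. g (p (a + i)) (p (a + Suc i))) = S a b"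
        using that sum.shift_bounds_nat_ivl[of "\<lambda>i. g (p i) (p (Suc i))" 0 a "b - a"]
        by (simp add: S_def add.commute atLeast0LessThan)
      finally show ?thesis using that by simp
    qed
    have "0 \<in> K" using False S_nonneg[of 0 n] by (simp add: K_def s_def S_def)
    moreover have "finite K" by (simp add: K_def)
    ultimately have KM: "Max K \<in> K" "\<And>k. k \<in> K \<Longrightarrow> k \<le> Max K"
      using Max_in by auto
    define k where "k = Max K"
    have k: "k < n" "S 0 k \<le> s / 2" using KM by (auto simp: k_def K_def)
    have "S (Suc k) n \<le> s / 2"
    proof (cases "Suc k < n")
      case True
      have "Suc k \<notin> K" using KM(2)[of "Suc k"] by (auto simp: k_def)
      with True have "S 0 (Suc k) > s / 2" by (simp add: K_def)
      then show ?thesis using split[of 0 "Suc k" n] True by (simp add: s_def)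
    next
      case False
      then show ?thesis using S_nonneg[of 0 n] by (simp add: S_def s_def)
    qed
    moreover have "S k (Suc k) \<le> s"
      using split[of 0 k "Suc k"] split[of 0 "Suc k" n] S_nonneg[of 0 k] S_nonneg[of "Suc k" n] k
      by (simp add: s_def)
    moreover have "S k (Suc k) = g (p k) (p (Suc k))" by (simp add: S_def)
    ultimately have "g (p 0) (p k) \<le> s" "g (p k) (p (Suc k)) \<le> s" "g (p (Suc k)) (p n) \<le> s"
      using IH[of 0 k] IH[of "Suc k" n] k by auto
    then have "g (p 0) (p n) \<le> 2 * s" by (rule three)
    then show ?thesis by (simp add: s_def S_def atLeast0LessThan)
  qed
qed

text \<open>Frink's chain argument without symmetry: \<open>d\<close> is the infimum of the
  \<open>g\<close>-lengths of chains. Concatenation gives the triangle inequality, one-link chains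
  the upper bound \<open>g\<close>, and \<open>chain_bound\<close> the lower bound
  \<open>g / 2\<close>.\<close>

lemma Frink_quasi_pseudometric:
  fixes g :: "'a \<Rightarrow> 'a \<Rightarrow> real"
  assumes refl: "\<And>x. g x x = 0" and nonneg: "\<And>x y. 0 \<le> g x y"
    and three: "\<And>x y z w e. g x y \<le> e \<Longrightarrow> g y z \<le> e \<Longrightarrow> g z w \<le> e \<Longrightarrow> g x w \<le> 2 * e"
  obtains d where "quasi_pseudometric d" "\<And>x y. d x y \<le> g x y" "\<And>x y. g x y \<le> 2 * d x y"
proof -
  define C where "C x y = {(\<Sum>i<n. g (p i) (p (Suc i))) | n p. p 0 = x \<and> p n = y}" for x y
  define d where "d x y = Inf (C x y)" for x y
  have lower: "g x y / 2 \<le> c" if c: "c \<in> C x y" for c x y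
  proof -
    obtain n p where "c = (\<Sum>i<n. g (p i) (p (Suc i)))" "p 0 = x" "p n = y"
      using c unfolding C_def by blast
    moreover have "g (p 0) (p n) \<le> 2 * (\<Sum>i<n. g (p i) (p (Suc i)))"
      using refl nonneg three by (rule chain_bound)
    ultimately show ?thesis by simp
  qed
  have g_in: "g x y \<in> C x y" for x y
    unfolding C_def by (rule CollectI, rule exI[of _ 1], rule exI[of _ "\<lambda>i. if i = 0 then x else y"]) simp
  have bdd: "bdd_below (C x y)" for x y
    using lower by (meson bdd_belowI)
  have le: "d x y \<le> c" if "c \<in> C x y" for c x y
    unfolding d_def using bdd that by (simp add: cInf_lower)
  have ge: "g x y / 2 \<le> d x y" for x y
    unfolding d_def
  proof (rule cInf_greatest)
    show "C x y \<noteq> {}" using g_in by blast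
  qed (rule lower)
  have C_add: "a + b \<in> C x z" if ab: "a \<in> C x y" "b \<in> C y z" for a b x y z
  proof -
    obtain n p where p: "a = (\<Sum>i<n. g (p i) (p (Suc i)))" "p 0 = x" "p n = y"
      using ab(1) unfolding C_def by blast
    obtain m q where q: "b = (\<Sum>i<m. g (q i) (q (Suc i)))" "q 0 = y" "q m = z"
      using ab(2) unfolding C_def by blast
    define h where "h i = (if i \<le> n then p i else q (i - n))" for i
    have h_add: "h (i + n) = q i" for i
      using p q by (simp add: h_def)
    have "(\<Sum>i<n+m. g (h i) (h (Suc i))) =
        (\<Sum>i=0..<n. g (h i) (h (Suc i))) + (\<Sum>i=n..<n+m. g (h i) (h (Suc i)))"
      by (simp add: sum.atLeastLessThan_concat flip: atLeast0LessThan)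
    also have "(\<Sum>i=0..<n. g (h i) (h (Suc i))) = a"
      unfolding p(1) atLeast0LessThan by (rule sum.cong) (auto simp: h_def)
    also have "(\<Sum>i=n..<n+m. g (h i) (h (Suc i))) = (\<Sum>i=0..<m. g (h (i + n)) (h (Suc i + n)))"
      using sum.shift_bounds_nat_ivl[of "\<lambda>i. g (h i) (h (Suc i))" 0 n m] by (simp add: add.commute)
    also have "\<dots> = b"
      unfolding q(1) atLeast0LessThan h_add ..
    finally have "a + b = (\<Sum>i<n+m. g (h i) (h (Suc i)))" by simp
    moreover have "h 0 = x" using p by (simp add: h_def)
    moreover have "h (n + m) = z" using h_add[of m] q by (simp add: add.commute)
    ultimately show ?thesis unfolding C_def by blast
  qed
  have tri: "d x z \<le> d x y + d y z" for x y z
  proof -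
    have "d x z - b \<le> d x y" if "b \<in> C y z" for b
      unfolding d_def[of x y]
    proof (rule cInf_greatest)
      show "C x y \<noteq> {}" using g_in by blast
      show "d x z - b \<le> a" if "a \<in> C x y" for a
        using le[OF C_add[OF that \<open>b \<in> C y z\<close>]] by simp
    qed
    then have "d x z - d x y \<le> d y z"
      unfolding d_def[of y z]
    proof (intro cInf_greatest)
      show "C y z \<noteq> {}" using g_in by blast
    qed (simp add: algebra_simps)
    then show ?thesis by simp
  qed
  have "d x x = 0" for x
    using le[OF g_in, of x x] ge[of x x] by (simp add: refl)
  moreover have "0 \<le> d x y" for x y
    using ge[of x y] nonneg[of x y] by simp
  ultimately have "quasi_pseudometric d"
    using tri by (simp add: quasi_pseudometric_def)
  then show ?thesis
    using that[of d] le[OF g_in] ge by (simp add: field_simps)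
qed


section \<open>Closure properties of quasi-uniformities\<close>

lemma quasi_uniformity_superset:
  assumes "quasi_uniformity X \<U>" "U \<in> \<U>" "U \<subseteq> V" "V \<subseteq> X \<times> X"
  shows "V \<in> \<U>"
proof -
  have "\<forall>U\<in>\<U>. \<forall>V. U \<subseteq> V \<and> V \<subseteq> X \<times> X \<longrightarrow> V \<in> \<U>"
    using assms(1) unfolding quasi_uniformity_def by (elim conjE)
  with assms(2-4) show ?thesis by blast
qed

lemma quasi_uniformity_entourage:
  assumes "quasi_uniformity X \<U>" "U \<in> \<U>"
  shows "U \<subseteq> X \<times> X" "\<And>x. x \<in> X \<Longrightarrow> (x, x) \<in> U"
proof -
  have "Id_on X \<subseteq> U \<and> U \<subseteq> X \<times> X"
    using assms(1)[unfolded quasi_uniformity_def, THEN conjunct2, THEN conjunct1] assms(2) by (rule bspec)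
  then show "U \<subseteq> X \<times> X" "\<And>x. x \<in> X \<Longrightarrow> (x, x) \<in> U" by auto
qed

lemma quasi_uniformity_Int:
  assumes "quasi_uniformity X \<U>" "U \<in> \<U>" "V \<in> \<U>"
  shows "U \<inter> V \<in> \<U>"
proof -
  have "\<forall>U\<in>\<U>. \<forall>V\<in>\<U>. U \<inter> V \<in> \<U>"
    using assms(1) unfolding quasi_uniformity_def by (elim conjE)
  with assms(2,3) show ?thesis by blast
qed

lemma quasi_uniformity_full:
  assumes "quasi_uniformity X \<U>"
  shows "X \<times> X \<in> \<U>"
proof -
  have "\<U> \<noteq> {}"
    using assms unfolding quasi_uniformity_def by (elim conjE)
  then obtain U where U: "U \<in> \<U>" by blast
  show ?thesis
    by (rule quasi_uniformity_superset[OF assms U quasi_uniformity_entourage(1)[OF assms U] subset_refl])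
qed

lemma quasi_uniformity_half:
  assumes "quasi_uniformity X \<U>" "U \<in> \<U>"
  obtains V where "V \<in> \<U>" "V O V \<subseteq> U"
proof -
  have "\<forall>U\<in>\<U>. \<exists>V\<in>\<U>. V O V \<subseteq> U"
    using assms(1) unfolding quasi_uniformity_def by (elim conjE)
  with assms(2) that show ?thesis by blast
qed

lemma quasi_uniformity_INT:
  assumes "quasi_uniformity X \<U>" "finite F" "\<And>i. i \<in> F \<Longrightarrow> U i \<in> \<U>"
  shows "(X \<times> X) \<inter> (\<Inter>i\<in>F. U i) \<in> \<U>"
  using assms(2,3)
proof (induction F rule: finite_induct)
  case empty
  then show ?case using quasi_uniformity_full[OF assms(1)] by simp
next
  case (insert i F)
  then have "U i \<inter> ((X \<times> X) \<inter> (\<Inter>i\<in>F. U i)) \<in> \<U>"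
    using quasi_uniformity_Int[OF assms(1)] by simp
  then show ?case by (simp add: Int_left_commute)
qed

section \<open>Quasi-pseudometrics from entourages\<close>

text \<open>The metrization lemma for normal sequences in non-symmetric form. The condition on
  triple composites is the three-step inequality of Frink's lemma for a dyadic gauge
  \<open>g\<close>.\<close>

lemma normal_sequence_quasi_pseudometric:
  fixes M :: "nat \<Rightarrow> ('a \<times> 'a) set"
  assumes M0: "M 0 = UNIV" and refl: "\<And>x k. (x, x) \<in> M k"
    and M3: "\<And>k. M (Suc k) O M (Suc k) O M (Suc k) \<subseteq> M k"
  obtains d where "quasi_pseudometric d" "\<And>x y. d x y \<le> 1"
    "\<And>x y k. (x, y) \<in> M k \<Longrightarrow> d x y \<le> (1/2) ^ k"
    "\<And>x y k. d x y < (1/2) ^ Suc k \<Longrightarrow> (x, y) \<in> M (Suc k)"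
proof -
  have "M (Suc k) \<subseteq> M k" for k
  proof
    fix z assume "z \<in> M (Suc k)"
    then have "z \<in> M (Suc k) O M (Suc k) O M (Suc k)"
      using refl by (cases z) blast
    then show "z \<in> M k" using M3 by blast
  qed
  then have anti: "M l \<subseteq> M k" if "k \<le> l" for k l
    using that by (rule lift_Suc_antimono_le)
  \<comment> \<open>The first level missing a pair is positive because \<open>M 0\<close> is
    everything. The factor 2 thus makes \<open>g\<close> equal to \<open>(1/2) ^ l\<close>, where
    \<open>l\<close> is the last level containing the pair.\<close>
  define g :: "'a \<Rightarrow> 'a \<Rightarrow> real" where
    "g x y = (if \<forall>k. (x, y) \<in> M k then 0 else 2 * (1/2) ^ (LEAST k. (x, y) \<notin> M k))" for x y
  have g_iff: "g x y \<le> (1/2) ^ k \<longleftrightarrow> (x, y) \<in> M k" "g x y < (1/2) ^ k \<longleftrightarrow> (x, y) \<in> M (Suc k)" for x y k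
  proof -
    have "(g x y \<le> (1/2) ^ k \<longleftrightarrow> (x, y) \<in> M k) \<and> (g x y < (1/2) ^ k \<longleftrightarrow> (x, y) \<in> M (Suc k))"
    proof (cases "\<forall>k. (x, y) \<in> M k")
      case True
      then show ?thesis by (simp add: g_def)
    next
      case False
      define m where "m = (LEAST k. (x, y) \<notin> M k)"
      from False have "\<exists>k. (x, y) \<notin> M k" by blast
      then have m: "(x, y) \<notin> M m" unfolding m_def by (rule LeastI_ex)
      have "(x, y) \<in> M k \<longleftrightarrow> k < m" for k
        using anti[of m k] m not_less_Least[of k "\<lambda>k. (x, y) \<notin> M k"]
        by (metis linorder_not_less m_def subsetD)
      moreover obtain l where l: "m = Suc l" using m M0 by (cases m) auto
      moreover have "g x y = (1/2) ^ l"
        unfolding g_def m_def[symmetric] using False l by simp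
      moreover have "(1/2::real) ^ l \<le> (1/2) ^ k \<longleftrightarrow> k \<le> l"
        by (rule power_decreasing_iff) auto
      moreover have "(1/2::real) ^ l < (1/2) ^ k \<longleftrightarrow> k < l"
        by (rule power_strict_decreasing_iff) auto
      ultimately show ?thesis
        by (simp only: Suc_less_eq)(simp add: less_Suc_eq_le)
    qed
    then show "g x y \<le> (1/2) ^ k \<longleftrightarrow> (x, y) \<in> M k" "g x y < (1/2) ^ k \<longleftrightarrow> (x, y) \<in> M (Suc k)"
      by auto
  qed
  have nonneg: "0 \<le> g x y" for x y by (simp add: g_def)
  have g1: "g x y \<le> 1" for x y using g_iff(1)[of x y 0] M0 by simp
  have three: "g x w \<le> 2 * e" if e: "g x y \<le> e" "g y z \<le> e" "g z w \<le> e" for x y z w e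
  proof (rule ccontr)
    assume "\<not> g x w \<le> 2 * e"
    then have less: "2 * e < g x w" by simp
    then have ex: "\<exists>k. (x, w) \<notin> M k"
      using nonneg[of x y] e by (auto simp: g_def split: if_splits)
    define m where "m = (LEAST k. (x, w) \<notin> M k)"
    have m: "(x, w) \<notin> M m" unfolding m_def using ex by (rule LeastI_ex)
    have "g x w = 2 * (1/2) ^ m"
      unfolding g_def m_def[symmetric] using m by auto
    \<comment> \<open>Three links of gauge below \<open>(1/2) ^ m\<close> lie in
      \<open>M (Suc m)\<close>, so their composite lies in \<open>M m\<close>, against the choice of
      \<open>m\<close>.\<close>
    with less have "e < (1/2) ^ m" by simp
    then have "(x, y) \<in> M (Suc m)" "(y, z) \<in> M (Suc m)" "(z, w) \<in> M (Suc m)"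
      using e unfolding g_iff(2)[symmetric] by auto
    then have "(x, w) \<in> M m" using M3[of m] by blast
    with m show False ..
  qed
  have "g x x = 0" for x using refl by (simp add: g_def)
  then obtain d where d: "quasi_pseudometric d" "\<And>x y. d x y \<le> g x y" "\<And>x y. g x y \<le> 2 * d x y"
    using Frink_quasi_pseudometric[of g] nonneg three by metis
  show ?thesis
  proof (rule that)
    show "d x y \<le> 1" for x y
      using d(2)[of x y] g1[of x y] by linarith
    show "d x y \<le> (1/2) ^ k" if "(x, y) \<in> M k" for x y k
      using d(2)[of x y] that unfolding g_iff(1)[symmetric] by linarith
    show "(x, y) \<in> M (Suc k)" if "d x y < (1/2) ^ Suc k" for x y k
      using d(3)[of x y] that unfolding g_iff(2)[symmetric] by simp
  qed (fact d)
qed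

text \<open>Halving twice gives entourages with small triple composites; iterating this from
  \<open>U\<close> by dependent choice yields a normal sequence.\<close>

lemma quasi_uniformity_quasi_pseudometric:
  assumes qu: "quasi_uniformity X \<U>" and U: "U \<in> \<U>"
  obtains d r where "quasi_pseudometric d" "\<And>x y. d x y \<le> 1"
    "\<And>e. e > 0 \<Longrightarrow> {(x, y) \<in> X \<times> X. d x y < e} \<in> \<U>"
    "r > 0" "{(x, y) \<in> X \<times> X. d x y < r} \<subseteq> U"
proof -
  have step: "\<exists>W. W \<in> \<U> \<and> W O W O W \<subseteq> V" if V: "V \<in> \<U>" for V
  proof -
    obtain V' where V': "V' \<in> \<U>" "V' O V' \<subseteq> V" using quasi_uniformity_half[OF qu V] .
    obtain W where W: "W \<in> \<U>" "W O W \<subseteq> V'" using quasi_uniformity_half[OF qu V'(1)] .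
    have "W \<subseteq> V'"
    proof
      fix z assume "z \<in> W"
      moreover from this have "(fst z, fst z) \<in> W"
        using quasi_uniformity_entourage[OF qu W(1)] by (cases z) auto
      ultimately have "z \<in> W O W" by (cases z) auto
      then show "z \<in> V'" using W by blast
    qed
    then have "W O W O W \<subseteq> V" using W V' by blast
    with W show ?thesis by blast
  qed
  have "\<exists>N. \<forall>n. (N n \<in> \<U> \<and> (n = 0 \<longrightarrow> N n = U)) \<and> N (Suc n) O N (Suc n) O N (Suc n) \<subseteq> N n"
  proof (rule dependent_nat_choice)
    show "\<exists>V. V \<in> \<U> \<and> (0 = (0::nat) \<longrightarrow> V = U)" using U by blast
  qed (use step in blast)
  then obtain N :: "nat \<Rightarrow> ('a \<times> 'a) set" where N: "\<And>n. N n \<in> \<U>" "N 0 = U"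
    "\<And>n. N (Suc n) O N (Suc n) O N (Suc n) \<subseteq> N n" by metis
  have NX: "N n \<subseteq> X \<times> X" "\<forall>x\<in>X. (x, x) \<in> N n" for n
    using quasi_uniformity_entourage[OF qu N(1)] by auto
  \<comment> \<open>The shift by one supplies \<open>M 0 = UNIV\<close>. The diagonal is added
    because \<open>d\<close> lives on the whole type, whereas entourages relate only points of
    \<open>X\<close>.\<close>
  define M where "M n = (case n of 0 \<Rightarrow> UNIV | Suc k \<Rightarrow> N k \<union> Id)" for n
  have M3: "M (Suc k) O M (Suc k) O M (Suc k) \<subseteq> M k" for k
  proof (cases k)
    case (Suc l)
    \<comment> \<open>A chain starting in \<open>X\<close> stays in \<open>X\<close>, where
      \<open>N k\<close> is reflexive; a chain starting outside \<open>X\<close> is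
      constant.\<close>
    have "(x, w) \<in> N l \<union> Id" if "(x, y) \<in> N k \<union> Id" "(y, z) \<in> N k \<union> Id" "(z, w) \<in> N k \<union> Id"
      for x y z w
    proof (cases "x \<in> X")
      case True
      have "(u, v) \<in> N k \<and> v \<in> X" if "(u, v) \<in> N k \<union> Id" "u \<in> X" for u v
        using that NX[of k] by auto
      then have "(x, y) \<in> N k" "(y, z) \<in> N k" "(z, w) \<in> N k"
        using that True by metis+
      then have "(x, w) \<in> N (Suc l) O N (Suc l) O N (Suc l)" unfolding Suc by blast
      then show ?thesis using N(3) by blast
    next
      case False
      have "v = u" if "(u, v) \<in> N k \<union> Id" "u \<notin> X" for u v
        using that NX(1)[of k] by auto
      then have "w = x" using that False by metis
      then show ?thesis by simp
    qed
    then have "(N k \<union> Id) O (N k \<union> Id) O (N k \<union> Id) \<subseteq> N l \<union> Id" by (metis relcompEpair subrelI)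
    then show ?thesis by (simp add: M_def Suc)
  qed (simp add: M_def)
  have "M 0 = UNIV" "(x, x) \<in> M k" for x :: 'a and k
    by (simp_all add: M_def split: nat.split)
  then obtain d where d: "quasi_pseudometric d" "\<And>x y. d x y \<le> 1"
    "\<And>x y k. (x, y) \<in> M k \<Longrightarrow> d x y \<le> (1/2) ^ k"
    "\<And>x y k. d x y < (1/2) ^ Suc k \<Longrightarrow> (x, y) \<in> M (Suc k)"
    using normal_sequence_quasi_pseudometric[of M, OF _ _ M3] by blast
  show ?thesis
  \<comment> \<open>Pairs at distance below \<open>1/2\<close> lie in
    \<open>M 1 = U \<union> Id\<close>, and within \<open>X\<close> the diagonal belongs to
    \<open>U\<close>.\<close>
  proof (rule that[of d "1/2"])
    fix e :: real assume "e > 0"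
    then obtain k where k: "(1/2) ^ k < e" using real_arch_pow_inv[of e "1/2"] by auto
    have "N k \<subseteq> {(x, y) \<in> X \<times> X. d x y < e}"
    proof
      fix z assume "z \<in> N k"
      then have "(fst z, snd z) \<in> M (Suc k)" "z \<in> X \<times> X" using NX by (auto simp: M_def)
      moreover have "(1/2) ^ Suc k \<le> ((1/2) ^ k :: real)" by simp
      ultimately have "d (fst z) (snd z) < e"
        using d(3)[of "fst z" "snd z" "Suc k"] k by linarith
      with \<open>z \<in> X \<times> X\<close> show "z \<in> {(x, y) \<in> X \<times> X. d x y < e}"
        by (simp add: case_prod_unfold mem_Times_iff)
    qed
    then show "{(x, y) \<in> X \<times> X. d x y < e} \<in> \<U>"
      using quasi_uniformity_superset[OF qu N(1)] by blast
  next
    show "{(x, y) \<in> X \<times> X. d x y < 1 / 2} \<subseteq> U"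
      using d(4)[where k = 0] NX[of 0] N(2) by (auto simp: M_def)
  qed (use d in auto)
qed

subsection \<open>Quasi-proximity classes\<close>

lemma qprox_class_quasi_uniformity:
  assumes "\<V> \<in> qprox_class X \<delta>" shows "quasi_uniformity X \<V>"
  using assms by (simp add: qprox_class_def)

lemma qprox_class_not_near_iff:
  assumes "\<V> \<in> qprox_class X \<delta>" "A \<subseteq> X" "B \<subseteq> X"
  shows "\<not> \<delta> A B \<longleftrightarrow> (\<exists>V\<in>\<V>. (A \<times> B) \<inter> V = {})"
proof -
  have "\<delta> = qu_proximity X \<V>" using assms(1) by (simp add: qprox_class_def)
  with assms(2,3) show ?thesis by (simp add: qu_proximity_def)
qed

text \<open>If an entourage of one member of the class misses a rectangle, the rectangle is far, and
  then its complement is an entourage of every member. This carries information from a finer member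
  to the coarsest one.\<close>

lemma qprox_class_not_near_entourage:
  assumes \<V>: "\<V> \<in> qprox_class X \<delta>" and AB: "A \<subseteq> X" "B \<subseteq> X" "\<not> \<delta> A B"
  shows "X \<times> X - A \<times> B \<in> \<V>"
proof -
  have qu: "quasi_uniformity X \<V>" using \<V> by (rule qprox_class_quasi_uniformity)
  obtain V where V: "V \<in> \<V>" "(A \<times> B) \<inter> V = {}"
    using qprox_class_not_near_iff[OF \<V> AB(1,2)] AB(3) by blast
  have "V \<subseteq> X \<times> X - A \<times> B"
    using V quasi_uniformity_entourage(1)[OF qu V(1)] by blast
  then show ?thesis
    using quasi_uniformity_superset[OF qu V(1)] by blast
qed

text \<open>\<open>qu_proximity\<close> shrinks as the quasi-uniformity grows, so that of
  \<open>\<W>\<close> is squeezed between two copies of \<open>\<delta>\<close>.\<close>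

lemma qprox_class_sandwich:
  assumes \<V>: "\<V> \<in> qprox_class X \<delta>" and \<U>: "\<U> \<in> qprox_class X \<delta>"
    and "quasi_uniformity X \<W>" "\<V> \<subseteq> \<W>" "\<W> \<subseteq> \<U>"
  shows "\<W> \<in> qprox_class X \<delta>"
proof -
  have "qu_proximity X \<V> = \<delta>" "qu_proximity X \<U> = \<delta>"
    using \<V> \<U> by (simp_all add: qprox_class_def)
  moreover have "qu_proximity X \<U> A B \<Longrightarrow> qu_proximity X \<W> A B"
    "qu_proximity X \<W> A B \<Longrightarrow> qu_proximity X \<V> A B" for A B
    using assms(4,5) unfolding qu_proximity_def by (meson subsetD)+
  ultimately have "qu_proximity X \<W> = \<delta>" by (intro ext) metis
  with assms(3) show ?thesis by (simp add: qprox_class_def)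
qed

text \<open>Both topologies test whether \<open>{x}\<close> is far from the complement of
  \<open>G\<close>. Within the class, membership in \<open>trans_qus\<close> thus reduces to
  transitivity.\<close>

lemma qprox_class_compatible:
  assumes "qp_compatible T \<delta>" and \<W>: "\<W> \<in> qprox_class (topspace T) \<delta>"
  shows "qu_compatible T \<W>"
  unfolding qu_compatible_def
proof (intro allI)
  fix G
  have "\<not> \<delta> {x} (topspace T - G) \<longleftrightarrow> (\<exists>U\<in>\<W>. U `` {x} \<subseteq> G)"
    if "G \<subseteq> topspace T" "x \<in> G" for x
  proof -
    have "({x} \<times> (topspace T - G)) \<inter> U = {} \<longleftrightarrow> U `` {x} \<subseteq> G" if "U \<in> \<W>" for U
      using quasi_uniformity_entourage(1)[OF qprox_class_quasi_uniformity[OF \<W>] that] by blast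
    then show ?thesis
      using qprox_class_not_near_iff[OF \<W>, of "{x}" "topspace T - G"] that by auto
  qed
  then show "openin T G \<longleftrightarrow> G \<subseteq> topspace T \<and> (\<forall>x\<in>G. \<exists>U\<in>\<W>. U `` {x} \<subseteq> G)"
    using assms(1) unfolding qp_compatible_def by auto
qed

text \<open>The cells of the finite partition generated by \<open>F\<close> are small of order \<open>V\<close>.\<close>

definition totally_bounded_qu :: "'a set \<Rightarrow> ('a \<times> 'a) set set \<Rightarrow> bool" where
  "totally_bounded_qu X \<V> \<longleftrightarrow> (\<forall>V\<in>\<V>. \<exists>F :: 'a set set. finite F \<and>
     (\<forall>x\<in>X. \<forall>y\<in>X. {A \<in> F. x \<in> A} = {A \<in> F. y \<in> A} \<longrightarrow> (x, y) \<in> V))"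

section \<open>Total boundedness of the coarsest member\<close>

text \<open>Complements of finite unions of far rectangles form a base of a quasi-uniformity
  \<open>\<T>\<close> that again induces \<open>\<delta>\<close>, so \<open>\<V>\<close> is
  contained in \<open>\<T>\<close>. Each such complement contains the squares of the cells of a
  finite partition.\<close>

lemma coarsest_totally_bounded:
  assumes qp: "quasi_proximity X \<delta>" and \<V>: "\<V> \<in> qprox_class X \<delta>"
    and coarsest: "\<forall>\<W>\<in>qprox_class X \<delta>. \<V> \<subseteq> \<W>"
  shows "totally_bounded_qu X \<V>"
proof -
  define far where "far P \<longleftrightarrow> finite P \<and> (\<forall>p\<in>P. fst p \<subseteq> X \<and> snd p \<subseteq> X \<and> \<not> \<delta> (fst p) (snd p))"
    for P :: "('a set \<times> 'a set) set"
  define ent where "ent P = X \<times> X - (\<Union>p\<in>P. fst p \<times> snd p)" for P :: "('a set \<times> 'a set) set"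
  define \<T> where "\<T> = {E. E \<subseteq> X \<times> X \<and> (\<exists>P. far P \<and> ent P \<subseteq> E)}"
  have qu\<V>: "quasi_uniformity X \<V>" using \<V> by (rule qprox_class_quasi_uniformity)
  have disjoint: "A \<inter> B = {}" if "A \<subseteq> X" "B \<subseteq> X" "\<not> \<delta> A B" for A B
    using qp that unfolding quasi_proximity_def by metis
  have interpolate: "\<forall>A B. A \<subseteq> X \<and> B \<subseteq> X \<and> \<not> \<delta> A B \<longrightarrow> (\<exists>C. C \<subseteq> X \<and> \<not> \<delta> A C \<and> \<not> \<delta> (X - C) B)"
    using qp unfolding quasi_proximity_def by (elim conjE)
  have ent_in: "ent P \<in> \<V>" if P: "far P" for P
  proof -
    have "(X \<times> X) \<inter> (\<Inter>p\<in>P. X \<times> X - fst p \<times> snd p) \<in> \<V>"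
    proof (rule quasi_uniformity_INT[OF qu\<V>])
      show "finite P" using P by (simp add: far_def)
      show "X \<times> X - fst p \<times> snd p \<in> \<V>" if "p \<in> P" for p
        using P that by (intro qprox_class_not_near_entourage[OF \<V>]) (auto simp: far_def)
    qed
    moreover have "(X \<times> X) \<inter> (\<Inter>p\<in>P. X \<times> X - fst p \<times> snd p) = ent P"
      by (auto simp: ent_def)
    ultimately show ?thesis by simp
  qed
  have diag: "(x, x) \<in> ent P" if "far P" "x \<in> X" for x P
  proof -
    have "fst p \<inter> snd p = {}" if "p \<in> P" for p
      using \<open>far P\<close> that by (intro disjoint) (auto simp: far_def)
    then show ?thesis using that(2) by (auto simp: ent_def)
  qed
  \<comment> \<open>An interpolating set \<open>C p\<close> splits each far pair: the midpoint
    \<open>b\<close> lies in \<open>C p\<close>, which the first new rectangle forbids, or in its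
    complement, which the second forbids.\<close>
  have half: "\<exists>Q. far Q \<and> ent Q O ent Q \<subseteq> ent P" if P: "far P" for P
  proof -
    have "\<forall>p\<in>P. \<exists>C. C \<subseteq> X \<and> \<not> \<delta> (fst p) C \<and> \<not> \<delta> (X - C) (snd p)"
    proof
      fix p assume "p \<in> P"
      then have "fst p \<subseteq> X" "snd p \<subseteq> X" "\<not> \<delta> (fst p) (snd p)"
        using P by (auto simp: far_def)
      then show "\<exists>C. C \<subseteq> X \<and> \<not> \<delta> (fst p) C \<and> \<not> \<delta> (X - C) (snd p)"
        using interpolate by blast
    qed
    then obtain C where C: "\<forall>p\<in>P. C p \<subseteq> X \<and> \<not> \<delta> (fst p) (C p) \<and> \<not> \<delta> (X - C p) (snd p)"
      by metis
    define Q where "Q = (\<lambda>p. (fst p, C p)) ` P \<union> (\<lambda>p. (X - C p, snd p)) ` P"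
    have "far Q" using P C by (simp add: far_def Q_def ball_Un)
    moreover have "(a, c) \<in> ent P" if ab: "(a, b) \<in> ent Q" "(b, c) \<in> ent Q" for a b c
    proof -
      have "\<not> (a \<in> fst p \<and> c \<in> snd p)" if p: "p \<in> P" for p
      proof
        assume ac: "a \<in> fst p \<and> c \<in> snd p"
        have "(fst p, C p) \<in> Q" "(X - C p, snd p) \<in> Q" using p by (auto simp: Q_def)
        then have "\<not> (a \<in> fst p \<and> b \<in> C p)" "\<not> (b \<in> X - C p \<and> c \<in> snd p)" "b \<in> X"
          using ab by (auto simp: ent_def)
        with ac show False by blast
      qed
      moreover have "a \<in> X" "c \<in> X" using ab by (auto simp: ent_def)
      ultimately show ?thesis by (auto simp: ent_def)
    qed
    ultimately show ?thesis by blast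
  qed
  have ent_sub: "ent P \<subseteq> X \<times> X" for P by (auto simp: ent_def)
  have far_empty: "far {}" and far_Un: "far P \<Longrightarrow> far Q \<Longrightarrow> far (P \<union> Q)" for P Q
    by (auto simp: far_def)
  have ent_Un: "ent (P \<union> Q) = ent P \<inter> ent Q" for P Q by (auto simp: ent_def)
  have "quasi_uniformity X \<T>"
    unfolding quasi_uniformity_def
  proof (intro conjI ballI allI impI)
    show "\<T> \<noteq> {}" unfolding \<T>_def using far_empty ent_sub by blast
    show "Id_on X \<subseteq> U" if "U \<in> \<T>" for U
      using that diag unfolding \<T>_def by fastforce
    show "U \<subseteq> X \<times> X" if "U \<in> \<T>" for U
      using that by (simp add: \<T>_def)
    show "U \<inter> V \<in> \<T>" if UV: "U \<in> \<T>" "V \<in> \<T>" for U V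
    proof -
      obtain P Q where "far P" "ent P \<subseteq> U" "far Q" "ent Q \<subseteq> V"
        using UV unfolding \<T>_def by blast
      then have "far (P \<union> Q)" "ent (P \<union> Q) \<subseteq> U \<inter> V"
        using far_Un ent_Un by blast+
      with UV show ?thesis unfolding \<T>_def by blast
    qed
    show "V \<in> \<T>" if "U \<in> \<T>" "U \<subseteq> V \<and> V \<subseteq> X \<times> X" for U V
      using that unfolding \<T>_def by blast
    show "\<exists>V\<in>\<T>. V O V \<subseteq> U" if U: "U \<in> \<T>" for U
    proof -
      obtain P where P: "far P" "ent P \<subseteq> U" using U unfolding \<T>_def by blast
      obtain Q where Q: "far Q" "ent Q O ent Q \<subseteq> ent P" using half[OF P(1)] by blast
      have "ent Q \<in> \<T>" unfolding \<T>_def using Q(1) ent_sub by blast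
      with Q P show ?thesis by blast
    qed
  qed
  moreover have "\<T> \<subseteq> \<V>"
    unfolding \<T>_def using ent_in quasi_uniformity_superset[OF qu\<V>] by blast
  then have near: "qu_proximity X \<T> A B" if "\<delta> A B" for A B
  proof -
    have "qu_proximity X \<V> A B" using that \<V> by (simp add: qprox_class_def)
    with \<open>\<T> \<subseteq> \<V>\<close> show ?thesis unfolding qu_proximity_def by (meson subsetD)
  qed
  have "\<delta> A B" if AB: "qu_proximity X \<T> A B" for A B
  proof (rule ccontr)
    assume "\<not> \<delta> A B"
    with AB have "far {(A, B)}" by (simp add: far_def qu_proximity_def)
    then have "ent {(A, B)} \<in> \<T>" using ent_sub unfolding \<T>_def by blast
    then show False using AB by (auto simp: qu_proximity_def ent_def)
  qed
  with near have "qu_proximity X \<T> = \<delta>" by blast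
  ultimately have "\<V> \<subseteq> \<T>" by (intro coarsest[rule_format]) (simp add: qprox_class_def)
  show ?thesis
    unfolding totally_bounded_qu_def
  proof
    fix V assume "V \<in> \<V>"
    with \<open>\<V> \<subseteq> \<T>\<close> obtain P where P: "far P" "ent P \<subseteq> V" unfolding \<T>_def by blast
    show "\<exists>F :: 'a set set. finite F \<and>
        (\<forall>x\<in>X. \<forall>y\<in>X. {A \<in> F. x \<in> A} = {A \<in> F. y \<in> A} \<longrightarrow> (x, y) \<in> V)"
    \<comment> \<open>The first sides of the rectangles suffice: one containing \<open>x\<close>
      also contains \<open>y\<close>, and it is disjoint from its second side.\<close>
    proof (intro exI[of _ "fst ` P"] conjI ballI impI)
      show "finite (fst ` P)" using P by (simp add: far_def)
      fix x y assume xy: "x \<in> X" "y \<in> X" "{A \<in> fst ` P. x \<in> A} = {A \<in> fst ` P. y \<in> A}"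
      have "\<not> (x \<in> fst p \<and> y \<in> snd p)" if p: "p \<in> P" for p
      proof -
        have "fst p \<inter> snd p = {}" using P(1) p by (intro disjoint) (auto simp: far_def)
        moreover have "x \<in> fst p \<longleftrightarrow> y \<in> fst p" using xy(3) p by blast
        ultimately show ?thesis by blast
      qed
      then have "(x, y) \<in> ent P" using xy by (auto simp: ent_def)
      then show "(x, y) \<in> V" using P by blast
    qed
  qed
qed

section \<open>Separated sequences\<close>

text \<open>Greedy choice. If it stopped at a finite set \<open>F\<close>, the two-sided
  \<open>s\<close>-balls about \<open>F\<close> would cover \<open>X\<close>, and finitely many far
  rectangles would show \<open>U \<in> \<V>\<close>.\<close>

lemma ex_separated_sequence:
  assumes \<V>: "\<V> \<in> qprox_class X \<delta>" and \<U>: "\<U> \<in> qprox_class X \<delta>"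
    and d: "quasi_pseudometric d" and d\<U>: "\<And>e. e > 0 \<Longrightarrow> {(x, y) \<in> X \<times> X. d x y < e} \<in> \<U>"
    and r: "r > 0" and U: "{(x, y) \<in> X \<times> X. d x y < r} \<subseteq> U" "U \<subseteq> X \<times> X" "U \<notin> \<V>"
  obtains x :: "nat \<Rightarrow> 'a" where "range x \<subseteq> X"
    "\<And>i j. i \<noteq> j \<Longrightarrow> r / 4 \<le> d (x i) (x j) \<or> r / 4 \<le> d (x j) (x i)"
proof -
  define s where "s = r / 4"
  define sep where "sep y z \<longleftrightarrow> s \<le> d y z \<or> s \<le> d z y" for y z
  have s: "s > 0" "r = 4 * s" using r by (simp_all add: s_def)
  have tri: "d a c \<le> d a b + d b c" for a b c
    using d by (simp add: quasi_pseudometric_def)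
  have qu: "quasi_uniformity X \<V>" using \<V> by (rule qprox_class_quasi_uniformity)
  have ext: "\<exists>y\<in>X. \<forall>z\<in>F. sep z y" if F: "finite F" "F \<subseteq> X" for F
  proof (rule ccontr)
    assume "\<not> (\<exists>y\<in>X. \<forall>z\<in>F. sep z y)"
    then have close: "\<exists>z\<in>F. d z y < s \<and> d y z < s" if "y \<in> X" for y
      using that by (force simp: sep_def not_le)
    \<comment> \<open>From \<open>A z\<close> to \<open>B z\<close> the distance is at least
      \<open>s\<close>, so an entourage of \<open>\<U>\<close> misses the rectangle. Off all
      rectangles, with \<open>z\<close> close to \<open>a\<close>,
      \<open>d a b \<le> d a z + d z b < s + 2 * s < r\<close>.\<close>
    define A where "A z = {y \<in> X. d z y < s}" for z
    define B where "B z = {y \<in> X. 2 * s \<le> d z y}" for z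
    have "(X \<times> X) \<inter> (\<Inter>z\<in>F. X \<times> X - A z \<times> B z) \<in> \<V>"
    proof (rule quasi_uniformity_INT[OF qu F(1)])
      fix z
      have "s \<le> d a b" if "a \<in> A z" "b \<in> B z" for a b
        using that tri[of z b a] by (simp add: A_def B_def)
      then have "(A z \<times> B z) \<inter> {(x, y) \<in> X \<times> X. d x y < s} = {}" by fastforce
      moreover have "A z \<subseteq> X" "B z \<subseteq> X" by (auto simp: A_def B_def)
      ultimately show "X \<times> X - A z \<times> B z \<in> \<V>"
        using qprox_class_not_near_entourage[OF \<V>] qprox_class_not_near_iff[OF \<U>] d\<U>[OF s(1)]
        by blast
    qed
    moreover have "(X \<times> X) \<inter> (\<Inter>z\<in>F. X \<times> X - A z \<times> B z) \<subseteq> U"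
    proof
      fix p assume p: "p \<in> (X \<times> X) \<inter> (\<Inter>z\<in>F. X \<times> X - A z \<times> B z)"
      obtain a b where ab: "p = (a, b)" "a \<in> X" "b \<in> X" using p by auto
      then obtain z where z: "z \<in> F" "d z a < s" "d a z < s" using close by blast
      then have "a \<in> A z" using ab by (simp add: A_def)
      with p ab z have "b \<notin> B z" by blast
      then have "d z b < 2 * s" using ab by (simp add: B_def)
      then have "d a b < r" using tri[of a b z] z s by linarith
      then show "p \<in> U" using U(1) ab by blast
    qed
    ultimately show False
      using quasi_uniformity_superset[OF qu] U(2,3) by blast
  qed
  have "\<exists>x :: nat \<Rightarrow> 'a. \<forall>n. x n \<in> X \<and> (\<forall>m<n. sep (x m) (x n))"
  proof (rule dependent_wellorder_choice)
    fix n :: nat and x :: "nat \<Rightarrow> 'a"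
    assume "\<And>m. m < n \<Longrightarrow> x m \<in> X \<and> (\<forall>k<m. sep (x k) (x m))"
    then have "x ` {..<n} \<subseteq> X" by blast
    with ext[of "x ` {..<n}"] show "\<exists>y. y \<in> X \<and> (\<forall>m<n. sep (x m) y)"
      by auto
  qed simp
  then obtain x :: "nat \<Rightarrow> 'a" where x: "\<And>n. x n \<in> X" "\<And>m n. m < n \<Longrightarrow> sep (x m) (x n)"
    by blast
  show ?thesis
  proof (rule that)
    show "range x \<subseteq> X" using x(1) by blast
    show "r / 4 \<le> d (x i) (x j) \<or> r / 4 \<le> d (x j) (x i)" if "i \<noteq> j" for i j
      using x(2)[of i j] x(2)[of j i] that unfolding sep_def s_def by (meson linorder_neqE_nat)
  qed
qed


subsection \<open>Quasi-uniformities generated by families of blocks\<close>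

text \<open>Consecutive intervals whose sizes outgrow every finite number of cells, as the
  pigeonhole argument below requires.\<close>

definition block :: "nat \<Rightarrow> nat set" where
  "block n = {2 ^ n..<2 ^ Suc n}"

lemma card_block: "card (block n) = 2 ^ n"
  by (simp add: block_def)

lemma block_ge: "i \<in> block n \<Longrightarrow> n \<le> i"
  using less_exp[of n] unfolding block_def atLeastLessThan_iff by linarith

lemma block_less:
  assumes "m < n" "i \<in> block m" "j \<in> block n"
  shows "i < j"
proof -
  have "(2::nat) ^ Suc m \<le> 2 ^ n" using assms(1) by (intro power_increasing) auto
  with assms(2,3) show ?thesis unfolding block_def atLeastLessThan_iff by linarith
qed

locale separated_sequence =
  fixes X :: "'a set" and \<V> \<U> :: "('a \<times> 'a) set set"
    and d :: "'a \<Rightarrow> 'a \<Rightarrow> real" and x :: "nat \<Rightarrow> 'a" and r :: real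
  assumes qu\<V>: "quasi_uniformity X \<V>" and qu\<U>: "quasi_uniformity X \<U>" and sub: "\<V> \<subseteq> \<U>"
    and tb: "totally_bounded_qu X \<V>"
    and d: "quasi_pseudometric d" and d_le: "\<And>y z. d y z \<le> 1"
    and d\<U>: "\<And>e. e > 0 \<Longrightarrow> {(y, z) \<in> X \<times> X. d y z < e} \<in> \<U>"
    and xX: "x i \<in> X"
    and r: "r > 0"
    and sep: "i \<noteq> j \<Longrightarrow> r \<le> d (x i) (x j) \<or> r \<le> d (x j) (x i)"
    and C1: "pairs_Cauchy (\<lambda>i j. d (x i) (x j))"
    and C2: "pairs_Cauchy (\<lambda>i j. d (x j) (x i))"
begin

text \<open>One-sided uniform equicontinuity of the functions \<open>d (x j)\<close>. A union of
  index sets corresponds to an intersection of these relations, which is why \<open>gen\<close> only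
  needs one \<open>W\<close> for a finite set of branches.\<close>

definition W :: "nat set \<Rightarrow> real \<Rightarrow> ('a \<times> 'a) set" where
  "W A e = {(y, z). \<forall>n\<in>A. \<forall>j\<in>block n. d (x j) z - d (x j) y < e}"

definition gen :: "nat set set \<Rightarrow> ('a \<times> 'a) set set" where
  "gen S = {E. E \<subseteq> X \<times> X \<and>
     (\<exists>V\<in>\<V>. \<exists>F e. finite F \<and> F \<subseteq> S \<and> e > 0 \<and> V \<inter> W (\<Union> (branch ` F)) e \<subseteq> E)}"

lemma genI:
  assumes "E \<subseteq> X \<times> X" "V \<in> \<V>" "finite F" "F \<subseteq> S" "e > 0" "V \<inter> W (\<Union> (branch ` F)) e \<subseteq> E"
  shows "E \<in> gen S"
  using assms unfolding gen_def by blast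

lemma genE:
  assumes "E \<in> gen S"
  obtains V F e where "E \<subseteq> X \<times> X" "V \<in> \<V>" "finite F" "F \<subseteq> S" "e > 0"
    "V \<inter> W (\<Union> (branch ` F)) e \<subseteq> E"
  using assms unfolding gen_def by blast

lemma d_triangle: "d a c \<le> d a b + d b c" and d_refl: "d a a = 0" and d_nonneg: "0 \<le> d a b"
  using d by (simp_all add: quasi_pseudometric_def)

lemma W_mono: "A \<subseteq> B \<Longrightarrow> e \<le> e' \<Longrightarrow> W B e \<subseteq> W A e'"
  unfolding W_def by fastforce

lemma W_refl: "e > 0 \<Longrightarrow> (y, y) \<in> W A e"
  by (simp add: W_def)

lemma W_half: "W A (e / 2) O W A (e / 2) \<subseteq> W A e"
proof
  fix p assume "p \<in> W A (e / 2) O W A (e / 2)"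
  then obtain a b c where p: "p = (a, c)" "(a, b) \<in> W A (e / 2)" "(b, c) \<in> W A (e / 2)"
    by blast
  have "d (x j) c - d (x j) a < e" if "n \<in> A" "j \<in> block n" for n j
  proof -
    have "d (x j) b - d (x j) a < e / 2" "d (x j) c - d (x j) b < e / 2"
      using p that by (auto simp: W_def)
    then show ?thesis by linarith
  qed
  then show "p \<in> W A e" by (simp add: p W_def)
qed

text \<open>By the triangle inequality one ball serves all \<open>j\<close> and all \<open>A\<close>
  at once; this keeps every \<open>gen S\<close> below \<open>\<U>\<close>.\<close>

lemma ball_subset_W: "{(y, z) \<in> X \<times> X. d y z < e} \<subseteq> W A e"
proof -
  have "d (x j) z - d (x j) y < e" if "d y z < e" for j y z
    using d_triangle[of "x j" z y] that by linarith
  then show ?thesis by (auto simp: W_def)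
qed

lemma quasi_uniformity_gen: "quasi_uniformity X (gen S)"
  unfolding quasi_uniformity_def
proof (intro conjI ballI allI impI)
  have "X \<times> X \<in> gen S"
    by (rule genI[OF _ quasi_uniformity_full[OF qu\<V>], of _ "{}" _ 1]) auto
  then show "gen S \<noteq> {}" by blast
next
  fix U assume "U \<in> gen S"
  then show "U \<subseteq> X \<times> X" by (rule genE)
next
  fix U assume "U \<in> gen S"
  then obtain V F e where V: "V \<in> \<V>" and "e > 0" "V \<inter> W (\<Union> (branch ` F)) e \<subseteq> U"
    by (rule genE)
  then show "Id_on X \<subseteq> U"
    using quasi_uniformity_entourage(2)[OF qu\<V> V] W_refl by blast
next
  fix U U' assume "U \<in> gen S" "U' \<in> gen S"
  obtain V F e where U: "U \<subseteq> X \<times> X" "V \<in> \<V>" "finite F" "F \<subseteq> S" "e > 0"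
    "V \<inter> W (\<Union> (branch ` F)) e \<subseteq> U" using \<open>U \<in> gen S\<close> by (rule genE)
  obtain V' F' e' where U': "U' \<subseteq> X \<times> X" "V' \<in> \<V>" "finite F'" "F' \<subseteq> S" "e' > 0"
    "V' \<inter> W (\<Union> (branch ` F')) e' \<subseteq> U'" using \<open>U' \<in> gen S\<close> by (rule genE)
  show "U \<inter> U' \<in> gen S"
  proof (rule genI)
    have "W (\<Union> (branch ` (F \<union> F'))) (min e e') \<subseteq> W (\<Union> (branch ` F)) e"
      "W (\<Union> (branch ` (F \<union> F'))) (min e e') \<subseteq> W (\<Union> (branch ` F')) e'"
      by (intro W_mono; auto)+
    then show "(V \<inter> V') \<inter> W (\<Union> (branch ` (F \<union> F'))) (min e e') \<subseteq> U \<inter> U'"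
      using U(6) U'(6) by blast
  qed (use U U' quasi_uniformity_Int[OF qu\<V>] in auto)
next
  fix U U' assume "U \<in> gen S" and U': "U \<subseteq> U' \<and> U' \<subseteq> X \<times> X"
  obtain V F e where U: "V \<in> \<V>" "finite F" "F \<subseteq> S" "e > 0"
    "V \<inter> W (\<Union> (branch ` F)) e \<subseteq> U" using \<open>U \<in> gen S\<close> by (rule genE)
  show "U' \<in> gen S"
    by (rule genI[OF _ U(1-4)]) (use U' U in auto)
next
  fix U assume "U \<in> gen S"
  then obtain V F e where U: "U \<subseteq> X \<times> X" "V \<in> \<V>" "finite F" "F \<subseteq> S" "e > 0"
    "V \<inter> W (\<Union> (branch ` F)) e \<subseteq> U" by (rule genE)
  obtain V' where V': "V' \<in> \<V>" "V' O V' \<subseteq> V" using qu\<V> U(2) by (rule quasi_uniformity_half)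
  define E where "E = V' \<inter> W (\<Union> (branch ` F)) (e / 2)"
  have "E \<in> gen S"
    using U V' quasi_uniformity_entourage(1)[OF qu\<V> V'(1)]
    by (intro genI[of E V' F S "e / 2"]) (auto simp: E_def)
  moreover have "E O E \<subseteq> V \<inter> W (\<Union> (branch ` F)) e"
    using V'(2) W_half[of "\<Union> (branch ` F)" e] unfolding E_def by blast
  ultimately show "\<exists>E\<in>gen S. E O E \<subseteq> U" using U(6) by blast
qed

lemma coarsest_subset_gen: "\<V> \<subseteq> gen S"
proof
  fix V assume V: "V \<in> \<V>"
  show "V \<in> gen S"
    by (rule genI[OF quasi_uniformity_entourage(1)[OF qu\<V> V] V, of "{}" _ 1]) auto
qed

lemma gen_subset: "gen S \<subseteq> \<U>"
proof
  fix E assume "E \<in> gen S"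
  then obtain V F e where E: "E \<subseteq> X \<times> X" "V \<in> \<V>" "e > 0" "V \<inter> W (\<Union> (branch ` F)) e \<subseteq> E"
    by (rule genE)
  have "V \<inter> {(y, z) \<in> X \<times> X. d y z < e} \<in> \<U>"
    using E(2,3) sub d\<U> by (intro quasi_uniformity_Int[OF qu\<U>]) auto
  moreover have "V \<inter> {(y, z) \<in> X \<times> X. d y z < e} \<subseteq> E"
    using E(4) ball_subset_W[of e "\<Union> (branch ` F)"] by blast
  ultimately show "E \<in> \<U>" using E(1) by (rule quasi_uniformity_superset[OF qu\<U>])
qed

text \<open>For two-valued \<open>d\<close> a difference below \<open>1\<close> means
  \<open>d (x j) z \<le> d (x j) y\<close>, a transitive condition. So \<open>W B 1\<close> is
  transitive and lies in every \<open>W B e\<close>.\<close>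

lemma transitive_gen:
  assumes trans: "transitive_qu \<V>" and two_valued: "\<And>y z. d y z = 0 \<or> d y z = 1"
  shows "transitive_qu (gen S)"
  unfolding transitive_qu_def
proof
  fix E assume "E \<in> gen S"
  then obtain V F e where E: "V \<in> \<V>" "finite F" "F \<subseteq> S" "e > 0"
    "V \<inter> W (\<Union> (branch ` F)) e \<subseteq> E" by (rule genE)
  obtain V' where V': "V' \<in> \<V>" "trans V'" "V' \<subseteq> V"
    using trans E(1) unfolding transitive_qu_def by blast
  have less_iff: "d a b - d a c < e' \<longleftrightarrow> d a b \<le> d a c" if "0 < e'" "e' \<le> 1" for a b c e'
    using two_valued[of a b] two_valued[of a c] that by auto
  define B where "B = \<Union> (branch ` F)"
  have W1: "W B 1 = {(y, z). \<forall>n\<in>B. \<forall>j\<in>block n. d (x j) z \<le> d (x j) y}"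
    unfolding W_def by (simp add: less_iff)
  have "trans (W B 1)"
    unfolding W1 by (rule transI) (force intro: order_trans)
  then have "trans (V' \<inter> W B 1)" using V'(2) by (rule trans_Int[rotated])
  moreover have "W B 1 \<subseteq> W B e" unfolding W1 using E(4) by (fastforce simp: W_def)
  then have "V' \<inter> W B 1 \<subseteq> E" using V'(3) E(5) unfolding B_def by blast
  moreover have "V' \<inter> W B 1 \<in> gen S"
    using E V' quasi_uniformity_entourage(1)[OF qu\<V> V'(1)]
    by (intro genI[of _ V' F S 1]) (auto simp: B_def)
  ultimately show "\<exists>W\<in>gen S. trans W \<and> W \<subseteq> E" by blast
qed

text \<open>Pigeonhole over the block of a large element of \<open>A - B\<close>: two of its points lie in the same cell of
  a finite partition subordinate to \<open>V\<close> and are almost equidistant from the finitely many early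
  points, whereas the Cauchy property handles the late points of the other blocks.\<close>

lemma W_not_generated:
  assumes inf: "infinite (A - B)" and V: "V \<in> \<V>" and e: "e > 0"
  shows "\<not> V \<inter> W B e \<subseteq> W A r"
proof
  assume subW: "V \<inter> W B e \<subseteq> W A r"
  obtain N1 where N1: "\<And>i j k l. N1 \<le> i \<and> i < j \<and> N1 \<le> k \<and> k < l \<Longrightarrow>
      \<bar>d (x i) (x j) - d (x k) (x l)\<bar> < e"
    using C1 e unfolding pairs_Cauchy_def by meson
  obtain N2 where N2: "\<And>i j k l. N2 \<le> i \<and> i < j \<and> N2 \<le> k \<and> k < l \<Longrightarrow>
      \<bar>d (x j) (x i) - d (x l) (x k)\<bar> < e"
    using C2 e unfolding pairs_Cauchy_def by meson
  define N where "N = max N1 N2"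
  obtain F :: "'a set set" where F: "finite F"
    "\<forall>y\<in>X. \<forall>z\<in>X. {A \<in> F. y \<in> A} = {A \<in> F. z \<in> A} \<longrightarrow> (y, z) \<in> V"
    using bspec[OF tb[unfolded totally_bounded_qu_def] V] by (elim exE conjE)
  \<comment> \<open>The colour of \<open>i\<close> is the cell of \<open>x i\<close> together with
    the distances from the early points, \<open>j < N\<close>, rounded down in units of
    \<open>e\<close>.\<close>
  define c where "c i = ({A \<in> F. x i \<in> A}, map (\<lambda>j. nat \<lfloor>d (x j) (x i) / e\<rfloor>) [0..<N])" for i
  define K where "K = Pow F \<times> {xs. set xs \<subseteq> {..nat \<lfloor>1 / e\<rfloor>} \<and> length xs = N}"
  have "finite K"
    unfolding K_def using F(1) by (intro finite_cartesian_product finite_lists_length_eq) auto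
  have "c i \<in> K" for i
  proof -
    have "nat \<lfloor>d (x j) (x i) / e\<rfloor> \<le> nat \<lfloor>1 / e\<rfloor>" for j
      using d_le e by (intro nat_mono floor_mono divide_right_mono) auto
    then show ?thesis by (auto simp: c_def K_def)
  qed
  have "infinite (A - B - {..max N (card K)})" using inf by simp
  \<comment> \<open>\<open>N < n\<close> makes all indices in block \<open>n\<close> late, and
    \<open>card K < n < 2 ^ n\<close> gives the block more points than there are colours.\<close>
  then obtain n where "n \<in> A - B - {..max N (card K)}"
    using infinite_imp_nonempty by blast
  then have n: "n \<in> A" "n \<notin> B" "N < n" "card K < n" by auto
  have "\<not> inj_on c (block n)"
  proof
    assume "inj_on c (block n)"
    then have "card (block n) \<le> card K"
      using \<open>finite K\<close> \<open>\<And>i. c i \<in> K\<close> by (intro card_inj_on_le) auto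
    with n(4) less_exp[of n] show False unfolding card_block by linarith
  qed
  then obtain i k where ik: "i \<in> block n" "k \<in> block n" "i \<noteq> k" "c i = c k"
    by (auto simp: inj_on_def)
  \<comment> \<open>Stated for arbitrary \<open>i\<close> and \<open>k\<close> so as to apply in
    both directions: \<open>sep\<close> bounds one of the two distances from below, without telling
    which.\<close>
  have less_r: "d (x i) (x k) < r" if ik: "i \<in> block n" "k \<in> block n" "c i = c k" for i k
  proof -
    have "(x i, x k) \<in> V" using F(2) ik(3) xX by (simp add: c_def)
    moreover have "d (x j) (x k) - d (x j) (x i) < e" if m: "m \<in> B" "j \<in> block m" for m j
    proof (cases "j < N")
      case True
      have "nat \<lfloor>d (x j) (x i) / e\<rfloor> = nat \<lfloor>d (x j) (x k) / e\<rfloor>"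
        using ik(3) True by (simp add: c_def)
      moreover have "0 \<le> d (x j) (x i) / e" "0 \<le> d (x j) (x k) / e" using d_nonneg e by simp_all
      ultimately have "d (x j) (x k) / e - d (x j) (x i) / e < 1" by linarith
      then have "(d (x j) (x k) - d (x j) (x i)) / e < 1" by (simp add: diff_divide_distrib)
      then show ?thesis using e by (simp add: divide_less_eq)
    next
      case False
      have "N \<le> i" "N \<le> k" using block_ge ik n(3) by (meson less_imp_le order_trans)+
      \<comment> \<open>As \<open>n\<close> is not in \<open>B\<close>, the block of
        \<open>j\<close> lies wholly before or wholly after \<open>i\<close> and \<open>k\<close>.
        The distances compared then belong to two forward pairs or to two backward pairs.\<close>
      consider "m < n" | "n < m" using m n(2) by (metis linorder_neqE_nat)
      then show ?thesis
      proof cases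
        case 1
        then have "j < i" "j < k" using block_less m ik by blast+
        moreover have "N1 \<le> j" using False by (simp add: N_def)
        ultimately show ?thesis using N1[of j k j i] by simp
      next
        case 2
        then have "i < j" "k < j" using block_less m ik by blast+
        then show ?thesis using N2[of k j i j] \<open>N \<le> i\<close> \<open>N \<le> k\<close> by (simp add: N_def)
      qed
    qed
    then have "(x i, x k) \<in> W B e" by (simp add: W_def)
    ultimately have "(x i, x k) \<in> W A r" using subW by blast
    then have "d (x i) (x k) - d (x i) (x i) < r" using n(1) ik(1) unfolding W_def by blast
    then show ?thesis by (simp add: d_refl)
  qed
  from less_r[of i k] less_r[of k i] sep[OF ik(3)] ik show False by auto
qed

text \<open>For \<open>s \<in> S\<close> and \<open>gen S = gen S'\<close>, some
  \<open>V \<in> \<V>\<close> and a finite \<open>F \<subseteq> S'\<close> generate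
  \<open>W (branch s) r\<close> on \<open>X\<close>. By \<open>W_not_generated\<close> the branches
  of \<open>F\<close> then cover \<open>branch s\<close> up to a finite set, which forces
  \<open>s \<in> F\<close>.\<close>

lemma gen_inj: "inj gen"
proof -
  have "S \<subseteq> S'" if eq: "gen S = gen S'" for S S'
  proof
    fix s assume s: "s \<in> S"
    have "(X \<times> X) \<inter> W (branch s) r \<in> gen S"
      using s r by (intro genI[OF _ quasi_uniformity_full[OF qu\<V>], of _ "{s}" _ r]) auto
    then have "(X \<times> X) \<inter> W (branch s) r \<in> gen S'" using eq by simp
    then obtain V F e where V: "V \<in> \<V>" "finite F" "F \<subseteq> S'" "e > 0"
      "V \<inter> W (\<Union> (branch ` F)) e \<subseteq> (X \<times> X) \<inter> W (branch s) r" by (rule genE)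
    then have "\<not> infinite (branch s - \<Union> (branch ` F))"
      using W_not_generated[of "branch s" "\<Union> (branch ` F)" V e] by blast
    then show "s \<in> S'" using infinite_branch_minus[OF V(2)] V(3) by blast
  qed
  then show ?thesis by (intro injI) blast
qed

end

section \<open>Cardinality of the class\<close>

text \<open>The index set \<open>UNIV :: nat set set\<close> of the branches has the power of the
  continuum, so the injection \<open>gen\<close> provides \<open>2^(2^aleph_0)\<close>
  members.\<close>

lemma qprox_class_large:
  assumes qp: "quasi_proximity X \<delta>" and \<V>: "\<V> \<in> qprox_class X \<delta>"
    and coarsest: "\<forall>\<W>\<in>qprox_class X \<delta>. \<V> \<subseteq> \<W>"
    and \<U>: "\<U> \<in> qprox_class X \<delta>"
    and d: "quasi_pseudometric d" "\<And>x y. d x y \<le> 1"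
    and d\<U>: "\<And>e. e > 0 \<Longrightarrow> {(x, y) \<in> X \<times> X. d x y < e} \<in> \<U>"
    and r: "r > 0" and U: "{(x, y) \<in> X \<times> X. d x y < r} \<subseteq> U" "U \<subseteq> X \<times> X" "U \<notin> \<V>"
  shows "Pow (UNIV :: nat set set) \<lesssim> qprox_class X \<delta>"
    and "transitive_qu \<V> \<Longrightarrow> (\<And>x y. d x y = 0 \<or> d x y = 1) \<Longrightarrow>
      Pow (UNIV :: nat set set) \<lesssim> {\<W> \<in> qprox_class X \<delta>. transitive_qu \<W>}"
proof -
  obtain y :: "nat \<Rightarrow> 'a" where y: "range y \<subseteq> X"
    "\<And>i j. i \<noteq> j \<Longrightarrow> r / 4 \<le> d (y i) (y j) \<or> r / 4 \<le> d (y j) (y i)"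
    using ex_separated_sequence[OF \<V> \<U> d(1) d\<U> r U] by blast
  have "0 \<le> d a b" for a b using d(1) by (simp add: quasi_pseudometric_def)
  then obtain k :: "nat \<Rightarrow> nat" where k: "strict_mono k"
    "pairs_Cauchy (\<lambda>i j. d (y (k i)) (y (k j)))" "pairs_Cauchy (\<lambda>i j. d (y (k j)) (y (k i)))"
    using ex_subseq_pairs_Cauchy_both[of "\<lambda>i j. d (y i) (y j)"] d(2) by blast
  interpret separated_sequence X \<V> \<U> d "\<lambda>i. y (k i)" "r / 4"
  proof
    show "quasi_uniformity X \<V>" "quasi_uniformity X \<U>"
      using \<V> \<U> by (simp_all add: qprox_class_quasi_uniformity)
    show "\<V> \<subseteq> \<U>" using coarsest \<U> by (rule bspec)
    show "totally_bounded_qu X \<V>" using qp \<V> coarsest by (rule coarsest_totally_bounded)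
    show "r / 4 \<le> d (y (k i)) (y (k j)) \<or> r / 4 \<le> d (y (k j)) (y (k i))" if "i \<noteq> j" for i j
      using that y(2) k(1) by (simp add: strict_mono_eq)
  qed (use d d\<U> r y k in auto)
  have gen: "inj gen" "range gen \<subseteq> qprox_class X \<delta>"
    using gen_inj qprox_class_sandwich[OF \<V> \<U> quasi_uniformity_gen coarsest_subset_gen gen_subset]
    by auto
  then show "Pow (UNIV :: nat set set) \<lesssim> qprox_class X \<delta>"
    unfolding lepoll_def by auto
  show "Pow (UNIV :: nat set set) \<lesssim> {\<W> \<in> qprox_class X \<delta>. transitive_qu \<W>}"
    if "transitive_qu \<V>" "\<And>x y. d x y = 0 \<or> d x y = 1"
    using gen transitive_gen[OF that] unfolding lepoll_def by (intro exI[of _ gen]) auto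
qed

theorem theorem2p12:
  fixes T :: "'a topology" and \<delta> :: "'a set \<Rightarrow> 'a set \<Rightarrow> bool"
  assumes "quasi_proximity (topspace T) \<delta>"
    and "qp_compatible T \<delta>"
    and "\<exists>\<V>. \<V> \<in> qprox_class (topspace T) \<delta> \<and>
               (\<forall>\<W>\<in>qprox_class (topspace T) \<delta>. \<V> \<subseteq> \<W>) \<and> transitive_qu \<V>"
  shows "((\<exists>\<V>. qprox_class (topspace T) \<delta> = {\<V>})
          \<or> Pow (UNIV :: nat set set) \<lesssim> qprox_class (topspace T) \<delta>)
       \<and> ((\<exists>\<V>. qprox_class (topspace T) \<delta> \<inter> trans_qus T = {\<V>})
          \<or> Pow (UNIV :: nat set set) \<lesssim> qprox_class (topspace T) \<delta> \<inter> trans_qus T)"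
proof -
  define X where "X = topspace T"
  obtain \<V> where \<V>: "\<V> \<in> qprox_class X \<delta>" "transitive_qu \<V>"
    and coarsest: "\<forall>\<W>\<in>qprox_class X \<delta>. \<V> \<subseteq> \<W>"
    using assms(3) unfolding X_def by blast
  note large = qprox_class_large[OF assms(1)[folded X_def] \<V>(1) coarsest]
  have trans_iff: "\<W> \<in> trans_qus T \<longleftrightarrow> transitive_qu \<W>" if "\<W> \<in> qprox_class X \<delta>" for \<W>
    using qprox_class_compatible[OF assms(2)] qprox_class_quasi_uniformity that
    unfolding X_def trans_qus_def by blast
  have "Pow (UNIV :: nat set set) \<lesssim> qprox_class X \<delta>" if \<U>: "\<U> \<in> qprox_class X \<delta>" "\<U> \<noteq> \<V>" for \<U>
  proof -
    have qu: "quasi_uniformity X \<U>" using \<U>(1) by (rule qprox_class_quasi_uniformity)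
    obtain U where U: "U \<in> \<U>" "U \<notin> \<V>" using bspec[OF coarsest \<U>(1)] \<U>(2) by blast
    obtain d r where "quasi_pseudometric d" "\<And>x y. d x y \<le> 1"
      "\<And>e. e > 0 \<Longrightarrow> {(x, y) \<in> X \<times> X. d x y < e} \<in> \<U>"
      "r > 0" "{(x, y) \<in> X \<times> X. d x y < r} \<subseteq> U"
      using quasi_uniformity_quasi_pseudometric[OF qu U(1)] by blast
    then show ?thesis
      using quasi_uniformity_entourage(1)[OF qu U(1)] U(2) by (rule large(1)[OF \<U>(1)])
  qed
  then have general: "(\<exists>\<V>. qprox_class X \<delta> = {\<V>}) \<or> Pow (UNIV :: nat set set) \<lesssim> qprox_class X \<delta>"
    using \<V>(1) by blast
  have "Pow (UNIV :: nat set set) \<lesssim> qprox_class X \<delta> \<inter> trans_qus T"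
    if \<U>: "\<U> \<in> qprox_class X \<delta>" "\<U> \<in> trans_qus T" "\<U> \<noteq> \<V>" for \<U>
  proof -
    have qu: "quasi_uniformity X \<U>" using \<U>(1) by (rule qprox_class_quasi_uniformity)
    obtain U0 where U0: "U0 \<in> \<U>" "U0 \<notin> \<V>" using bspec[OF coarsest \<U>(1)] \<U>(3) by blast
    \<comment> \<open>A smaller entourage stays outside \<open>\<V>\<close>, which is closed under
      supersets.\<close>
    obtain U where U: "U \<in> \<U>" "trans U" "U \<subseteq> U0"
      using U0(1) trans_iff[OF \<U>(1)] \<U>(2) unfolding transitive_qu_def by blast
    have U\<V>: "U \<notin> \<V>"
      using quasi_uniformity_superset[OF qprox_class_quasi_uniformity[OF \<V>(1)] _ U(3)]
        quasi_uniformity_entourage(1)[OF qu U0(1)] U0(2) by blast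
    note UX = quasi_uniformity_entourage[OF qu U(1)]
    \<comment> \<open>Transitivity of \<open>U\<close> is the triangle inequality of this two-valued
      \<open>d\<close>; the diagonal is added for the points outside \<open>X\<close>.\<close>
    define d :: "'a \<Rightarrow> 'a \<Rightarrow> real" where "d x y = (if (x, y) \<in> U \<union> Id then 0 else 1)" for x y
    have "trans (U \<union> Id)" using U(2) by (auto simp: trans_def)
    then have "quasi_pseudometric d"
      unfolding quasi_pseudometric_def d_def by (auto dest: transD)
    moreover have ball: "U \<subseteq> {(x, y) \<in> X \<times> X. d x y < e}" if "e > 0" for e
      using that UX(1) by (auto simp: d_def)
    then have "{(x, y) \<in> X \<times> X. d x y < e} \<in> \<U>" if "e > 0" for e
      using that by (intro quasi_uniformity_superset[OF qu U(1)]) auto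
    moreover have "{(x, y) \<in> X \<times> X. d x y < 1} \<subseteq> U"
      using UX(2) by (auto simp: d_def split: if_splits)
    moreover have "d x y \<le> 1" "d x y = 0 \<or> d x y = 1" for x y by (simp_all add: d_def)
    ultimately have "Pow (UNIV :: nat set set) \<lesssim> {\<W> \<in> qprox_class X \<delta>. transitive_qu \<W>}"
      using UX(1) U\<V> \<V>(2) by (intro large(2)[OF \<U>(1), of d 1 U]) auto
    also have "{\<W> \<in> qprox_class X \<delta>. transitive_qu \<W>} = qprox_class X \<delta> \<inter> trans_qus T"
      using trans_iff by blast
    finally show ?thesis .
  qed
  \<comment> \<open>Being transitive, \<open>\<V>\<close> is in the intersection, which is a
    singleton unless it has a second member, the case just treated.\<close>
  moreover have "\<V> \<in> qprox_class X \<delta> \<inter> trans_qus T" using \<V> trans_iff by blast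
  ultimately have "(\<exists>\<V>. qprox_class X \<delta> \<inter> trans_qus T = {\<V>})
      \<or> Pow (UNIV :: nat set set) \<lesssim> qprox_class X \<delta> \<inter> trans_qus T"
    by blast
  with general show ?thesis unfolding X_def by blast
qed

end
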